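(* An infinite word over a finite alphabet is recurrent, balanced and rich if and only if it is a balanced episturmian word.
   Context: A finite word $w$ is rich if it has exactly $|w|+1$ distinct palindromic factors (including the empty word); an infinite word is rich if all its factors are rich. An infinite word is recurrent if each of its factors occurs infinitely often in it. A word is balanced if for any two factors $u,v$ with $|u|=|v|$ and any letter $x$, $||u|_x-|v|_x|\le 1$, where $|u|_x$ is the number of occurrences of $x$ in $u$. An infinite word $\mathbf t$ is episturmian if its set of factors is closed under reversal and, for each $n$, it has at most one factor $u$ of length $n$ that is right special (i.e. $ux$ and $uy$ are factors for two distinct letters $x\ne y$). *)

theory Defs
  imports Main "HOL-Library.Sublist" "HOL-Library.Omega_Words_Fun"
begin

definition factors :: "'a word \<Rightarrow> 'a list set" where
  "factors w = {subsequence w i j | i j. i \<le> j}"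

definition palindrome :: "'a list \<Rightarrow> bool" where
  "palindrome u \<longleftrightarrow> rev u = u"

text \<open>On lists, \<^const>\<open>sublist\<close> means contiguous block, i.e. factor of a finite word.\<close>

definition rich :: "'a list \<Rightarrow> bool" where
  "rich u \<longleftrightarrow> card {p. sublist p u \<and> palindrome p} = length u + 1"

definition rich_word :: "'a word \<Rightarrow> bool" where
  "rich_word w \<longleftrightarrow> (\<forall>u \<in> factors w. rich u)"

definition recurrent :: "'a word \<Rightarrow> bool" where
  "recurrent w \<longleftrightarrow>
     (\<forall>u \<in> factors w. infinite {i. subsequence w i (i + length u) = u})"

definition balanced :: "'a word \<Rightarrow> bool" where
  "balanced w \<longleftrightarrow>
     (\<forall>u \<in> factors w. \<forall>v \<in> factors w. length u = length v \<longrightarrow>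
        (\<forall>x. \<bar>int (count_list u x) - int (count_list v x)\<bar> \<le> 1))"

definition right_special :: "'a word \<Rightarrow> 'a list \<Rightarrow> bool" where
  "right_special w u \<longleftrightarrow>
     (\<exists>x y. x \<noteq> y \<and> u @ [x] \<in> factors w \<and> u @ [y] \<in> factors w)"

definition episturmian :: "'a word \<Rightarrow> bool" where
  "episturmian w \<longleftrightarrow>
     (\<forall>u \<in> factors w. rev u \<in> factors w) \<and>
     (\<forall>n. \<exists>\<^sub>\<le>\<^sub>1 u. u \<in> factors w \<and> length u = n \<and> right_special w u)"

end

theory Submission
  imports Defs
begin

text \<open>
  The link between the two sides is that a word is rich iff the complete returns to its palindromic
  factors are palindromes.

  \<^emph>\<open>From episturmian to rich.\<close> Closure under reversal gives recurrence. Let \<open>P\<close> be a right special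
  palindrome and \<open>T\<close> its longest proper palindromic suffix. Since \<open>T\<close> is the only right special factor
  of its length, a complete return to \<open>T\<close> is determined by its first letter after \<open>T\<close>, and \<open>P\<close> itself
  is the return to \<open>T\<close> with some letter \<open>d\<close>. As \<open>dT\<close> is right special, \<open>xT\<close> is not for \<open>x \<noteq> d\<close>, so
  a complete return to \<open>P\<close> passes through at most one other return to \<open>T\<close> and is a palindrome.

  \<^emph>\<open>From rich and balanced to episturmian.\<close> If \<open>yt\<close> and \<open>zt\<close> are distinct right special factors of
  minimal length, then \<open>t\<close> is a palindrome. Join letters \<open>u\<close> and \<open>v\<close> by an edge if \<open>utv\<close> is a factor;
  no letter lies on all edges. Balance excludes loops and shows that at most one of the letters
  involved occurs in \<open>t\<close>, so any other letter \<open>x\<close> occurs only within \<open>txt\<close>. The successive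
  occurrences of \<open>t\<close> describe a walk in this graph. Richness makes the walk come back to a letter
  along the edge by which it left, and balance, applied to the words \<open>utxtv\<close>, then forces all edges
  to share a letter, a contradiction.
\<close>

section \<open>Occurrences of factors\<close>

definition occurs :: "'a word \<Rightarrow> 'a list \<Rightarrow> nat \<Rightarrow> bool" where
  "occurs w u i \<longleftrightarrow> (\<forall>k < length u. w (i + k) = u ! k)"

text \<open>Positions replace lists here: the window is half-open and \<open>i + j\<close> fixes its
  centre, so concentric windows are compared by arithmetic.\<close>

definition pal_window :: "'a word \<Rightarrow> nat \<Rightarrow> nat \<Rightarrow> bool" where
  "pal_window w i j \<longleftrightarrow> (\<forall>k. i \<le> k \<and> k < j \<longrightarrow> w k = w (i + j - 1 - k))"

text \<open>Complete returns to palindromic factors are palindromes: the form of richness through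
  which both directions pass.\<close>

definition pal_returns :: "'a word \<Rightarrow> bool" where
  "pal_returns w \<longleftrightarrow> (\<forall>p i j. palindrome p \<and> occurs w p i \<and> occurs w p j \<and> i < j \<and>
     (\<forall>l. i < l \<and> l < j \<longrightarrow> \<not> occurs w p l) \<longrightarrow> pal_window w i (j + length p))"

definition rev_closed :: "'a word \<Rightarrow> bool" where
  "rev_closed w \<longleftrightarrow> (\<forall>u \<in> factors w. rev u \<in> factors w)"

text \<open>The episturmian bound at a single length, isolated because one direction proves it by
  induction on \<open>n\<close>.\<close>

definition unique_special :: "'a word \<Rightarrow> nat \<Rightarrow> bool" where
  "unique_special w n \<longleftrightarrow>
     (\<forall>u v. length u = n \<and> length v = n \<and> right_special w u \<and> right_special w v \<longrightarrow> u = v)"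

lemma last_before:
  fixes a b :: nat
  assumes "Q a" "a < b"
  obtains l where "Q l" "a \<le> l" "l < b" "\<And>l'. l < l' \<Longrightarrow> l' < b \<Longrightarrow> \<not> Q l'"
proof -
  let ?l = "GREATEST l. Q l \<and> l < b"
  have bound: "\<forall>l. Q l \<and> l < b \<longrightarrow> l \<le> b" by simp
  have "Q ?l \<and> ?l < b"
    using GreatestI_nat[where P = "\<lambda>l. Q l \<and> l < b"] assms bound by blast
  moreover have "l' \<le> ?l" if "Q l'" "l' < b" for l'
    using Greatest_le_nat[where P = "\<lambda>l. Q l \<and> l < b"] that bound by blast
  ultimately show ?thesis using that[of ?l] assms by (meson leD)
qed

lemma occurs_iff: "occurs w u i \<longleftrightarrow> subsequence w i (i + length u) = u"
  unfolding list_eq_iff_nth_eq[of _ u] by (simp add: occurs_def)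

lemma occurs_subsequence: "occurs w (subsequence w i j) i"
  by (simp add: occurs_def)

lemma factors_iff: "u \<in> factors w \<longleftrightarrow> (\<exists>i. occurs w u i)"
proof
  assume "u \<in> factors w"
  then show "\<exists>i. occurs w u i"
    using occurs_subsequence unfolding factors_def by blast
next
  assume "\<exists>i. occurs w u i"
  then obtain i where "subsequence w i (i + length u) = u"
    by (auto simp: occurs_iff)
  then show "u \<in> factors w"
    unfolding factors_def by (metis (mono_tags, lifting) le_add1 mem_Collect_eq)
qed

lemma occursD: "occurs w u i \<Longrightarrow> k < length u \<Longrightarrow> w (i + k) = u ! k"
  by (simp add: occurs_def)

lemma occurs_append:
  "occurs w (u @ v) i \<longleftrightarrow> occurs w u i \<and> occurs w v (i + length u)"
proof -
  have "occurs w v (i + length u)" if "occurs w (u @ v) i"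
    unfolding occurs_def
  proof (intro allI impI)
    fix k assume "k < length v"
    then show "w (i + length u + k) = v ! k"
      using that[unfolded occurs_def, rule_format, of "length u + k"]
      by (simp add: add.assoc)
  qed
  moreover have "occurs w u i" if "occurs w (u @ v) i"
    using that by (auto simp: occurs_def nth_append)
  moreover have "occurs w (u @ v) i" if "occurs w u i" "occurs w v (i + length u)"
    unfolding occurs_def
  proof (intro allI impI)
    fix k assume k: "k < length (u @ v)"
    show "w (i + k) = (u @ v) ! k"
    proof (cases "k < length u")
      case False
      then show ?thesis
        using k that(2)[unfolded occurs_def, rule_format, of "k - length u"]
        by (simp add: nth_append)
    qed (use that(1) in \<open>auto simp: occurs_def nth_append\<close>)
  qed
  ultimately show ?thesis by blast
qed

lemma occurs_Nil [simp]: "occurs w [] i"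
  by (simp add: occurs_def)

lemma occurs_single [simp]: "occurs w [x] i \<longleftrightarrow> w i = x"
  by (simp add: occurs_def)

lemma occurs_Cons: "occurs w (x # u) i \<longleftrightarrow> w i = x \<and> occurs w u (Suc i)"
  using occurs_append[of w "[x]" u i] by simp

lemma occurs_sub_iff:
  "occurs w (subsequence w i (i + n)) i' \<longleftrightarrow> (\<forall>k<n. w (i' + k) = w (i + k))"
  by (simp add: occurs_def)

lemma right_special_iff:
  "right_special w u \<longleftrightarrow>
     (\<exists>a b. occurs w u a \<and> occurs w u b \<and> w (a + length u) \<noteq> w (b + length u))"
  unfolding right_special_def factors_iff occurs_append by auto

lemma right_special_suffix:
  assumes "right_special w (u @ v)" shows "right_special w v"
proof -
  obtain a b where "occurs w (u @ v) a" "occurs w (u @ v) b"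
    "w (a + length (u @ v)) \<noteq> w (b + length (u @ v))"
    using assms unfolding right_special_iff by blast
  then show ?thesis
    unfolding right_special_iff occurs_append
    by (intro exI[of _ "a + length u"] exI[of _ "b + length u"]) (auto simp: add.assoc)
qed

lemma factors_append1: "u @ v \<in> factors w \<Longrightarrow> u \<in> factors w"
  unfolding factors_iff occurs_append by blast

lemma right_special_factor: "right_special w u \<Longrightarrow> u \<in> factors w"
  unfolding right_special_def using factors_append1 by fast

lemma palindrome_nth:
  "palindrome p \<longleftrightarrow> (\<forall>k < length p. p ! k = p ! (length p - 1 - k))"
  unfolding palindrome_def list_eq_iff_nth_eq[of _ p] by (simp add: rev_nth eq_commute)

lemma pal_window_occurs:
  assumes "occurs w p i"
  shows "pal_window w i (i + length p) \<longleftrightarrow> palindrome p"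
proof -
  have w: "w (i + k) = p ! k" if "k < length p" for k
    using assms that by (simp add: occurs_def)
  have "pal_window w i (i + length p) \<longleftrightarrow> (\<forall>k<length p. w (i + k) = w (i + (length p - 1 - k)))"
  proof
    assume l: "pal_window w i (i + length p)"
    show "\<forall>k<length p. w (i + k) = w (i + (length p - 1 - k))"
    proof (intro allI impI)
      fix k assume "k < length p"
      moreover from this have "i + (i + length p) - 1 - (i + k) = i + (length p - 1 - k)" by auto
      ultimately show "w (i + k) = w (i + (length p - 1 - k))"
        using l[unfolded pal_window_def, rule_format, of "i + k"] by (metis add_less_cancel_left le_add1)
    qed
  next
    assume r: "\<forall>k<length p. w (i + k) = w (i + (length p - 1 - k))"
    show "pal_window w i (i + length p)"
      unfolding pal_window_def
    proof (intro allI impI)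
      fix k assume "i \<le> k \<and> k < i + length p"
      moreover from this have "i + (length p - 1 - (k - i)) = i + (i + length p) - 1 - k" by auto
      ultimately show "w k = w (i + (i + length p) - 1 - k)"
        using r[rule_format, of "k - i"] by (metis le_add_diff_inverse less_diff_conv2 add.commute)
    qed
  qed
  also have "\<dots> \<longleftrightarrow> palindrome p"
    unfolding palindrome_nth
  proof (intro all_cong)
    fix k assume k: "k < length p"
    then have "length p - 1 - k < length p" by simp
    then show "w (i + k) = w (i + (length p - 1 - k)) \<longleftrightarrow> p ! k = p ! (length p - 1 - k)"
      by (simp only: w[OF k] w)
  qed
  finally show ?thesis .
qed

lemma pal_window_nth:
  "pal_window w i j \<Longrightarrow> i \<le> k \<Longrightarrow> k < j \<Longrightarrow> k + l + 1 = i + j \<Longrightarrow> w k = w l"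
  unfolding pal_window_def by (drule spec[of _ k]) (simp, metis add_diff_cancel_left' diff_Suc_1 diff_Suc_eq_diff_pred)

lemma pal_windowI:
  assumes "\<And>k l. i \<le> k \<Longrightarrow> k < j \<Longrightarrow> k + l + 1 = i + j \<Longrightarrow> w k = w l"
  shows "pal_window w i j"
  unfolding pal_window_def
proof (intro allI impI)
  fix k assume "i \<le> k \<and> k < j"
  then show "w k = w (i + j - 1 - k)" by (intro assms) auto
qed

lemma pal_window_inner:
  assumes "pal_window w i j" "a + b = i + j" "i \<le> a"
  shows "pal_window w a b"
  by (rule pal_windowI, rule pal_window_nth[OF assms(1)]) (use assms in auto)

lemma recurrent_iff:
  "recurrent w \<longleftrightarrow> (\<forall>u i N. occurs w u i \<longrightarrow> (\<exists>i' \<ge> N. occurs w u i'))"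
proof -
  have "infinite {i. occurs w u i} \<longleftrightarrow> (\<forall>N. \<exists>i' \<ge> N. occurs w u i')" for u
    by (simp add: infinite_nat_iff_unbounded_le)
  then show ?thesis
    unfolding recurrent_def occurs_iff[symmetric] by (simp add: Ball_def factors_iff)
qed

lemma rev_closed_occurs:
  assumes "rev_closed w" "occurs w u i"
  obtains j where "occurs w (rev u) j"
  using assms that unfolding rev_closed_def Ball_def factors_iff by meson

text \<open>At the first difference beyond \<open>t\<close>, the preceding window of length
  \<open>length t\<close> is right special, hence equals \<open>t\<close>, and this puts an
  occurrence of \<open>t\<close> strictly between \<open>i\<close> and \<open>i'\<close>.\<close>

lemma return_forced:
  assumes uni: "unique_special w (length t)"
    and rs: "right_special w t"
    and occ: "occurs w t i" "occurs w t j"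
    and none: "\<And>l. i < l \<Longrightarrow> l < i' \<Longrightarrow> \<not> occurs w t l"
    and same: "w (i + length t) = w (j + length t)"
    and k: "k < i' - i + length t"
  shows "w (i + k) = w (j + k)"
  using k
proof (induction k rule: less_induct)
  case (less k)
  consider "k < length t" | "k = length t" | "k > length t" by linarith
  then show ?case
  proof cases
    case 3
    show ?thesis
    proof (rule ccontr)
      assume neq: "w (i + k) \<noteq> w (j + k)"
      define a where "a = k - length t"
      define u where "u = subsequence w (i + a) (i + a + length t)"
      have len: "length u = length t" by (simp add: u_def)
      have "occurs w u (i + a)" unfolding u_def by (rule occurs_subsequence)
      moreover have "occurs w u (j + a)"
        unfolding u_def occurs_sub_iff
      proof (intro allI impI)
        fix m assume "m < length t"
        then show "w (j + a + m) = w (i + a + m)"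
          using less.IH[of "a + m"] less.prems 3 by (auto simp: a_def add.assoc)
      qed
      moreover have "w (i + a + length u) \<noteq> w (j + a + length u)"
        using neq 3 len by (simp add: a_def)
      ultimately have "right_special w u" unfolding right_special_iff by blast
      then have "u = t" using uni rs len by (auto simp: unique_special_def)
      then have "occurs w t (i + a)" using \<open>occurs w u (i + a)\<close> by simp
      then show False using none[of "i + a"] less.prems 3 unfolding a_def by linarith
    qed
  qed (use occ same in \<open>auto simp: occurs_def\<close>)
qed

section \<open>Palindromic factors of finite words\<close>

abbreviation pals :: "'a list \<Rightarrow> 'a list set" where
  "pals u \<equiv> {p. sublist p u \<and> palindrome p}"

lemma finite_pals: "finite (pals u)"
  by (rule finite_subset[of _ "set (sublists u)"]) auto

lemma sublist_snocD: "sublist p (u @ [x]) \<Longrightarrow> sublist p u \<or> Sublist.suffix p (u @ [x])"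
  using sublist_snoc[of p u x] by blast

text \<open>The shorter of two palindromic suffixes is also a proper prefix of the longer one.\<close>

lemma new_palindrome_unique:
  assumes "palindrome p" "Sublist.suffix p (u @ [x])" "\<not> sublist p u"
    and "palindrome q" "Sublist.suffix q (u @ [x])" "\<not> sublist q u"
  shows "p = q"
proof -
  have *: "p = q" if "palindrome p" "Sublist.suffix p (u @ [x])" "\<not> sublist p u"
    and "palindrome q" and sq: "Sublist.suffix q (u @ [x])" and "length p \<le> length q" for p q
  proof (rule ccontr)
    assume "p \<noteq> q"
    have "Sublist.suffix p q" using that suffix_length_suffix by blast
    then have "Sublist.prefix p q" using that(1,4) by (simp add: suffix_to_prefix palindrome_def)
    then obtain e where e: "q = p @ e" by (auto elim: prefixE)
    with \<open>p \<noteq> q\<close> have "e \<noteq> []" by auto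
    obtain c where "u @ [x] = c @ p @ e" using sq e by (auto elim: suffixE)
    then have "u = c @ p @ butlast e"
      using \<open>e \<noteq> []\<close> by (metis append_is_Nil_conv butlast_append butlast_snoc)
    then have "sublist p u" by (metis sublist_appendI)
    with that(3) show False by simp
  qed
  show ?thesis using *[of p q] *[of q p] assms by (metis nat_le_linear)
qed

lemma pals_snoc_new:
  assumes "palindrome p" "Sublist.suffix p (u @ [x])" "\<not> sublist p u"
  shows "pals (u @ [x]) = insert p (pals u)"
proof
  show "pals (u @ [x]) \<subseteq> insert p (pals u)"
  proof
    fix q assume q: "q \<in> pals (u @ [x])"
    show "q \<in> insert p (pals u)"
    proof (cases "sublist q u")
      case False
      then have "Sublist.suffix q (u @ [x])" using q sublist_snocD[of q u x] by blast
      then show ?thesis using new_palindrome_unique[OF assms, of q] q False by simp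
    qed (use q in simp)
  qed
  show "insert p (pals u) \<subseteq> pals (u @ [x])"
  proof
    fix q assume "q \<in> insert p (pals u)"
    then show "q \<in> pals (u @ [x])"
      using assms(1) suffix_imp_sublist[OF assms(2)] sublist_snoc[of q u x] by blast
  qed
qed

lemma pals_Nil: "pals [] = {[]}"
  by (auto simp: palindrome_def)

text \<open>By \<open>new_palindrome_unique\<close>, each appended letter contributes at most one
  new palindrome.\<close>

lemma card_pals_le: "card (pals u) \<le> length u + 1"
proof (induction u rule: rev_induct)
  case Nil
  then show ?case unfolding pals_Nil by simp
next
  case (snoc x u)
  show ?case
  proof (cases "\<exists>p. palindrome p \<and> Sublist.suffix p (u @ [x]) \<and> \<not> sublist p u")
    case True
    then obtain p where "pals (u @ [x]) = insert p (pals u)" using pals_snoc_new by metis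
    then have "card (pals (u @ [x])) \<le> Suc (card (pals u))"
      using finite_pals[of u] by (simp only: card_insert_if split: if_split) simp
    then show ?thesis using snoc by simp
  next
    case False
    have "pals (u @ [x]) \<subseteq> pals u"
    proof
      fix q assume "q \<in> pals (u @ [x])"
      then show "q \<in> pals u" using False sublist_snocD[of q u x] by blast
    qed
    then have "card (pals (u @ [x])) \<le> card (pals u)" by (rule card_mono[OF finite_pals])
    then show ?thesis using snoc by simp
  qed
qed

text \<open>Since \<open>u\<close> has at most \<open>length u + 1\<close> palindromes, the last
  letter must have created one, and a newly created factor is a suffix.\<close>

lemma rich_new_palindrome:
  assumes "rich (u @ [x])"
  obtains p where "palindrome p" "Sublist.suffix p (u @ [x])" "\<not> sublist p u"
proof -
  have "\<not> pals (u @ [x]) \<subseteq> pals u"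
    using card_mono[OF finite_pals, of "pals (u @ [x])" u] card_pals_le[of u] assms
    by (auto simp: rich_def)
  then obtain p where "sublist p (u @ [x])" "palindrome p" "\<not> sublist p u" by auto
  then show ?thesis using that sublist_snocD[of p u x] by blast
qed

lemma rich_snoc:
  assumes "rich u" "palindrome p" "Sublist.suffix p (u @ [x])" "\<not> sublist p u"
  shows "rich (u @ [x])"
  using assms pals_snoc_new[OF assms(2-4)] finite_pals[of u] by (simp add: rich_def)

section \<open>Episturmian words are rich\<close>

lemma occurs_drop:
  assumes "occurs w u i" "m \<le> length u"
  shows "occurs w (drop m u) (i + m)"
  using assms occurs_append[of w "take m u" "drop m u" i] by simp

lemma pal_window_drop:
  assumes "occurs w u i" "m \<le> length u"
  shows "pal_window w (i + m) (i + length u) \<longleftrightarrow> palindrome (drop m u)"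
  using pal_window_occurs[OF occurs_drop[OF assms]] assms(2) by (simp add: add.assoc)

text \<open>If the prefix \<open>v n\<close> occurs only at 0, an occurrence of
  \<open>rev (v n)\<close> at \<open>i\<close> makes the prefix of length \<open>i + n\<close> a
  palindrome, because its reversal begins with \<open>v n\<close> and so can only sit at 0.\<close>

lemma rev_closed_prefix_recurs:
  assumes rc: "rev_closed w"
  shows "\<exists>j>0. occurs w (subsequence w 0 n) j"
proof (rule ccontr)
  assume contr: "\<not> ?thesis"
  define v where "v m = subsequence w 0 m" for m
  have only0: "j = 0" if "occurs w (v n) j" for j
    using contr that by (auto simp: v_def)
  have len: "length (v m) = m" for m by (simp add: v_def)
  have v0: "occurs w (v m) 0" for m
    unfolding v_def by (rule occurs_subsequence)
  have split: "v (l + m) = v l @ subsequence w l (l + m)" for l m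
    unfolding v_def by (rule subsequence_append)
  have pal: "pal_window w 0 (i + n)" if i: "occurs w (rev (v n)) i" for i
  proof -
    obtain j where j: "occurs w (rev (v (i + n))) j"
      using rev_closed_occurs[OF rc v0] .
    have "subsequence w i (i + n) = rev (v n)"
      using i by (simp add: occurs_iff len)
    then have rv: "rev (v (i + n)) = v n @ rev (v i)"
      unfolding split by simp
    then have "j = 0" using j only0 by (simp add: occurs_append)
    then have "rev (v (i + n)) = v (i + n)"
      using j v0[of "i + n"] by (simp add: occurs_iff len)
    then show ?thesis
      using pal_window_occurs[OF v0[of "i + n"]] by (simp add: len palindrome_def)
  qed
  obtain i where i: "occurs w (rev (v n)) i"
    using rev_closed_occurs[OF rc v0] .
  \<comment> \<open>Reflecting in two palindromic prefixes in turn is a translation, which carries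
    \<open>v n\<close> to the positive position \<open>i2 - i1\<close>.\<close>
  have no_later: False if "i1 < i2" "occurs w (rev (v n)) i1" "occurs w (rev (v n)) i2" for i1 i2
  proof -
    have "occurs w (v n) (i2 - i1)"
      unfolding occurs_def
    proof (intro allI impI)
      fix k assume "k < length (v n)"
      then have k: "k < n" by (simp add: len)
      have "w (i2 - i1 + k) = w (i1 + n - 1 - k)"
        by (rule pal_window_nth[OF pal[OF that(3)]]) (use k that in auto)
      also have "\<dots> = w k"
        by (rule pal_window_nth[OF pal[OF that(2)]]) (use k that in auto)
      finally show "w (i2 - i1 + k) = v n ! k" using k by (simp add: v_def)
    qed
    then show False using only0 that by force
  qed
  \<comment> \<open>The reversal of a prefix longer by \<open>Suc i\<close> letters ends with
    \<open>rev (v n)\<close>, which yields an occurrence beyond \<open>i\<close>.\<close>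
  obtain i2 where i2: "occurs w (rev (v (n + Suc i))) i2"
    using rev_closed_occurs[OF rc v0] .
  then have "occurs w (rev (v n)) (i2 + Suc i)"
    unfolding split rev_append occurs_append by simp
  then show False using no_later[of i "i2 + Suc i"] i by simp
qed

text \<open>Every occurrence of a factor ends some prefix, and that prefix recurs further
  on.\<close>

lemma rev_closed_recurrent:
  assumes "rev_closed w" shows "recurrent w"
  unfolding recurrent_iff
proof (intro allI impI)
  fix u i N assume u: "occurs w u i"
  have later: "\<exists>i' > l. occurs w u i'" if "occurs w u l" for l
  proof -
    obtain j where j: "j > 0" "occurs w (subsequence w 0 (l + length u)) j"
      using rev_closed_prefix_recurs[OF assms] by blast
    have "subsequence w 0 (l + length u) = subsequence w 0 l @ u"
      using that by (simp add: subsequence_append occurs_iff)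
    then have "occurs w u (j + l)" using j by (simp add: occurs_append)
    then show ?thesis using j by (intro exI[of _ "j + l"]) simp
  qed
  show "\<exists>i' \<ge> N. occurs w u i'"
  proof (induction N)
    case (Suc N)
    then show ?case using later by (metis Suc_leI le_less_trans less_or_eq_imp_le)
  qed (use u in auto)
qed

text \<open>Induction on the length, through the suffix \<open>T\<close> of \<open>P\<close>. The
  outer letters mirror because \<open>P\<close> stands at both ends; the middle, from
  \<open>i + k\<close> to \<open>j + length T\<close>, is \<open>T\<close> itself or a single
  complete return to \<open>T\<close>.\<close>

lemma special_return_pal:
  assumes rc: "rev_closed w" and us: "\<And>n. unique_special w n"
    and "right_special w P" "palindrome P" "occurs w P i" "occurs w P j" "i < j"
    and "\<And>l. i < l \<Longrightarrow> l < j \<Longrightarrow> \<not> occurs w P l"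
  shows "pal_window w i (j + length P)"
  using assms(3-8)
proof (induction "length P" arbitrary: P i j rule: less_induct)
  case less
  show ?case
  proof (cases "P = []")
    case True
    then have "j = Suc i" using less.prems(5,6) by (metis Suc_lessI lessI occurs_Nil)
    then show ?thesis using True by (auto simp: pal_window_def less_Suc_eq)
  next
    case False
    \<comment> \<open>\<open>k\<close> is the shift from \<open>P\<close> to its longest proper
      palindromic suffix, which may be empty.\<close>
    define k where "k = (LEAST k. k > 0 \<and> palindrome (drop k P))"
    have ex: "length P > 0 \<and> palindrome (drop (length P) P)"
      using False by (simp add: palindrome_def)
    have k: "k > 0" "palindrome (drop k P)"
      using LeastI[of "\<lambda>k. k > 0 \<and> palindrome (drop k P)", OF ex] by (auto simp: k_def)
    have k_le: "k \<le> length P"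
      using Least_le[of "\<lambda>k. k > 0 \<and> palindrome (drop k P)", OF ex] by (simp add: k_def)
    have k_least: "\<not> palindrome (drop m P)" if "0 < m" "m < k" for m
      using not_less_Least[of m "\<lambda>k. k > 0 \<and> palindrome (drop k P)"] that by (auto simp: k_def)
    define T where "T = drop k P"
    have lenP: "length P = k + length T" using k_le by (simp add: T_def)
    have T_pal: "palindrome T" using k by (simp add: T_def)
    have T_rs: "right_special w T"
      using less.prems(1) right_special_suffix[of w "take k P" T] by (simp add: T_def)
    have T_end: "occurs w T (a + k)" if "occurs w P a" for a
      unfolding T_def by (rule occurs_drop[OF that k_le])
    have "rev T = take (length T) (rev P)"
      using k_le by (simp add: T_def rev_drop)
    then have "P = T @ drop (length T) P"
      using T_pal less.prems(2) by (metis append_take_drop_id palindrome_def)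
    then have T_start: "occurs w T a" if "occurs w P a" for a
      using that occurs_append by metis
    have IH: "pal_window w a (b + length T)" if "occurs w T a" "occurs w T b" "a < b"
      "\<And>l. a < l \<Longrightarrow> l < b \<Longrightarrow> \<not> occurs w T l" for a b
      using less.hyps[of T a b] that T_rs T_pal lenP k(1) by simp
    \<comment> \<open>From the last such occurrence to the end of \<open>P\<close> runs a complete
      return to \<open>T\<close>, palindromic by induction: a palindromic proper suffix of
      \<open>P\<close> longer than \<open>T\<close>.\<close>
    have none: "\<not> occurs w T l" if il: "i < l" "l < i + k" for l
    proof
      assume "occurs w T l"
      then obtain l' where l': "occurs w T l'" "l \<le> l'" "l' < i + k"
        "\<And>l''. l' < l'' \<Longrightarrow> l'' < i + k \<Longrightarrow> \<not> occurs w T l''"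
        using last_before[of "occurs w T" l "i + k"] il(2) by blast
      have "pal_window w l' (i + k + length T)"
        using IH[OF l'(1) T_end[OF less.prems(3)] l'(3)] l'(4) by blast
      then have "palindrome (drop (l' - i) P)"
        using pal_window_drop[OF less.prems(3), of "l' - i"] l' il lenP
        by (simp add: add.assoc)
      then show False using k_least[of "l' - i"] l' il by simp
    qed
    have i_pal: "pal_window w i (i + length P)"
      using pal_window_occurs less.prems by blast
    have j_pal: "pal_window w j (j + length P)"
      using pal_window_occurs less.prems by blast
    have j_ge: "i + k \<le> j"
      using none[of j] T_start[OF less.prems(4)] less.prems(5) by linarith
    have middle: "pal_window w (i + k) (j + length T)"
    proof (cases "j = i + k")
      case True
      then show ?thesis
        using pal_window_occurs[OF T_start[OF less.prems(4)]] T_pal by simp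
    next
      case False
      define m1 where "m1 = i + k"
      define m2 where "m2 = (LEAST m. m1 < m \<and> occurs w T m)"
      have j: "m1 < j \<and> occurs w T j"
        using False j_ge T_start[OF less.prems(4)] by (simp add: m1_def)
      have m2: "m1 < m2" "occurs w T m2"
        using LeastI[of "\<lambda>m. m1 < m \<and> occurs w T m", OF j] by (auto simp: m2_def)
      have m2_le: "m2 \<le> j"
        using Least_le[of "\<lambda>m. m1 < m \<and> occurs w T m", OF j] by (simp add: m2_def)
      have m2_least: "\<not> occurs w T m" if "m1 < m" "m < m2" for m
        using not_less_Least[of m "\<lambda>m. m1 < m \<and> occurs w T m"] that by (auto simp: m2_def)
      have m1: "occurs w T m1" using T_end less.prems(3) by (simp add: m1_def)
      have m_pal: "pal_window w m1 (m2 + length T)"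
        by (rule IH[OF m1 m2(2) m2(1) m2_least])
      have "m2 = j"
      proof (rule ccontr)
        assume "m2 \<noteq> j"
        then have m2j: "m2 < j" using m2_le by simp
        \<comment> \<open>\<open>x\<close> follows \<open>T\<close> at \<open>m1\<close> and
          precedes it at \<open>m2\<close>; \<open>d\<close> precedes \<open>T\<close> at
          \<open>m1\<close> and follows it at \<open>i\<close>. An occurrence of \<open>T\<close>
          followed by \<open>d\<close> starts an occurrence of \<open>P\<close>, so \<open>d\<close>
          follows \<open>T\<close> neither at \<open>m1\<close> nor at \<open>m2\<close>.\<close>
        define x where "x = w (m1 + length T)"
        define d where "d = w (m1 - 1)"
        have x': "w (m2 - 1) = x"
          unfolding x_def by (rule pal_window_nth[OF m_pal, symmetric]) (use m2 in auto)
        have d': "w (i + length T) = d"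
          unfolding d_def by (rule pal_window_nth[OF i_pal]) (use k lenP in \<open>auto simp: m1_def\<close>)
        have forced: "occurs w P m" if "occurs w T m" "w (m + length T) = d" for m
          unfolding occurs_def
        proof (intro allI impI)
          fix l assume l: "l < length P"
          have "w (i + l) = w (m + l)"
            by (rule return_forced[OF us T_rs T_start[OF less.prems(3)] that(1) none])
              (use that d' l lenP in auto)
          then show "w (m + l) = P ! l"
            using less.prems(3) l by (auto simp: occurs_def)
        qed
        have "x \<noteq> d"
          using forced[OF m1] less.prems(6)[of m1] j k by (auto simp: x_def m1_def)
        have x3: "w (m2 + length T) \<noteq> d"
          using forced[OF m2(2)] less.prems(6)[of m2] m2 m2j by (auto simp: m1_def)
        \<comment> \<open>Reversal gives \<open>x # T\<close> followed by \<open>d\<close>, while at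
          \<open>m2 - 1\<close> it is followed by another letter. Thus \<open>x # T\<close> is right
          special, as is the suffix \<open>d # T\<close> of \<open>P\<close>.\<close>
        have "occurs w (d # T @ [x]) (m1 - 1)"
          using m1 k by (simp add: occurs_Cons occurs_append d_def x_def m1_def)
        then obtain b where "occurs w (rev (d # T @ [x])) b"
          using rev_closed_occurs[OF rc] by blast
        then have b: "occurs w (x # T) b" "w (b + length (x # T)) = d"
          using T_pal by (simp_all add: occurs_Cons occurs_append palindrome_def)
        have "occurs w (x # T) (m2 - 1)" "w (m2 - 1 + length (x # T)) \<noteq> d"
          using m2 x' x3 by (simp_all add: occurs_Cons)
        then have "right_special w (x # T)"
          unfolding right_special_iff using b by metis
        moreover have "right_special w (d # T)"
        proof -
          have "w (i + (k - 1)) = P ! (k - 1)"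
            by (rule occursD[OF less.prems(3)]) (use k(1) k_le in simp)
          then have "P ! (k - 1) = d"
            using k(1) by (simp add: d_def m1_def)
          then have "drop (k - 1) P = d # T"
            using Cons_nth_drop_Suc[of "k - 1" P] k k_le by (simp add: T_def)
          then show ?thesis
            using less.prems(1) right_special_suffix[of w "take (k - 1) P" "d # T"]
            by (metis append_take_drop_id)
        qed
        ultimately have "x # T = d # T"
          using us[of "Suc (length T)"] unfolding unique_special_def by (metis length_Cons)
        with \<open>x \<noteq> d\<close> show False by simp
      qed
      with m_pal show ?thesis by (simp add: m1_def)
    qed
    have outer: "w a = w b" if "i \<le> a" "a < i + k" "a + b + 1 = i + (j + length P)" for a b
    proof -
      have "w (i + (a - i)) = P ! (a - i)" "w (j + (a - i)) = P ! (a - i)"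
        by (rule occursD[OF less.prems(3)], use that lenP in simp,
            rule occursD[OF less.prems(4)], use that lenP in simp)
      then have "w a = w (j + (a - i))" using that by simp
      also have "\<dots> = w b"
        by (rule pal_window_nth[OF j_pal]) (use that lenP in auto)
      finally show ?thesis .
    qed
    show ?thesis
    proof (rule pal_windowI)
      fix a b assume ab: "i \<le> a" "a < j + length P" "a + b + 1 = i + (j + length P)"
      consider "a < i + k" | "b < i + k" | "i + k \<le> a" "i + k \<le> b" by linarith
      then show "w a = w b"
      proof cases
        case 1
        then show ?thesis using outer ab by blast
      next
        case 2
        then show ?thesis using outer[of b a] ab by simp
      next
        case 3
        then show ?thesis
          by (intro pal_window_nth[OF middle]) (use ab lenP in auto)
      qed
    qed
  qed
qed

text \<open>If \<open>p\<close> is not right special, a single letter \<open>c\<close> always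
  follows it and, by reversal, always precedes it. Replacing \<open>p\<close> by
  \<open>c # p @ [c]\<close> uses up one letter of the extension and shifts the return one place
  left; the bound on \<open>length q\<close> leaves room for these shifts.\<close>

lemma extended_return_pal:
  assumes rc: "rev_closed w" and us: "\<And>n. unique_special w n"
    and "right_special w (p @ q)" "palindrome p" "occurs w p i" "occurs w p j" "i < j"
    and "\<And>l. i < l \<Longrightarrow> l < j \<Longrightarrow> \<not> occurs w p l" and "length q \<le> i"
  shows "pal_window w i (j + length p)"
  using assms(3-9)
proof (induction q arbitrary: p i j)
  case Nil
  then show ?case using special_return_pal[OF rc us] by simp
next
  case (Cons c q)
  show ?case
  proof (cases "right_special w p")
    case True
    then show ?thesis using special_return_pal[OF rc us] Cons.prems by blast
  next
    case False
    have rec: "recurrent w" by (rule rev_closed_recurrent[OF rc])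
    obtain a where "occurs w (p @ c # q) a"
      using right_special_factor[OF Cons.prems(1)] unfolding factors_iff by blast
    then have a: "occurs w p a" "w (a + length p) = c"
      by (auto simp: occurs_append occurs_Cons)
    have right: "w (l + length p) = c" if "occurs w p l" for l
      using False a that unfolding right_special_iff by blast
    have left: "w (l - 1) = c" if "occurs w p l" "l > 0" for l
    proof -
      have "occurs w (w (l - 1) # p) (l - 1)" using that by (simp add: occurs_Cons)
      then obtain b where "occurs w (rev (w (l - 1) # p)) b"
        using rev_closed_occurs[OF rc] by blast
      then show ?thesis
        using right[of b] Cons.prems(2) by (simp add: occurs_append palindrome_def)
    qed
    let ?p = "c # p @ [c]"
    have occ: "occurs w ?p (l - 1)" if "occurs w p l" "l > 0" for l
      using that left right by (simp add: occurs_Cons occurs_append)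
    have "?p @ q @ [x] \<in> factors w" if x: "(p @ c # q) @ [x] \<in> factors w" for x
    proof -
      \<comment> \<open>Recurrence avoids position 0, so that there is a letter to the left.\<close>
      obtain l where l: "l \<ge> 1" "occurs w ((p @ c # q) @ [x]) l"
        using x rec unfolding factors_iff recurrent_iff by metis
      then have "w (l - 1) = c" using left[of l] by (simp add: occurs_append)
      then have "occurs w (?p @ q @ [x]) (l - 1)"
        using l by (simp add: occurs_Cons)
      then show ?thesis unfolding factors_iff by blast
    qed
    then have rs: "right_special w (?p @ q)"
      using Cons.prems(1) unfolding right_special_def by fastforce
    have pal: "palindrome ?p" using Cons.prems(2) by (simp add: palindrome_def)
    have none: "\<not> occurs w ?p l" if "i - 1 < l" "l < j - 1" for l
      using Cons.prems(6)[of "Suc l"] that by (simp add: occurs_Cons occurs_append)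
    have ij: "i > 0" "j > 0" using Cons.prems(5,7) by auto
    have "pal_window w (i - 1) (j - 1 + length ?p)"
      using Cons.IH[OF rs pal occ[OF Cons.prems(3)] occ[OF Cons.prems(4)] _ none] ij Cons.prems(5,7)
      by simp
    then show ?thesis
      by (rule pal_window_inner) (use ij in auto)
  qed
qed

text \<open>If the return \<open>R\<close> is not a palindrome, it first differs from an occurrence
  of its reversal after a common prefix, which is right special. Both begin with \<open>p\<close>,
  so this prefix extends \<open>p\<close> and \<open>extended_return_pal\<close> applies.\<close>

lemma episturmian_pal_returns:
  assumes rc: "rev_closed w" and us: "\<And>n. unique_special w n"
  shows "pal_returns w"
  unfolding pal_returns_def
proof (intro allI impI, elim conjE)
  fix p i j
  assume p: "palindrome p" "occurs w p i" "occurs w p j" "i < j"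
    and none: "\<forall>l. i < l \<and> l < j \<longrightarrow> \<not> occurs w p l"
  define N where "N = j - i + length p"
  define R where "R = subsequence w i (i + N)"
  have lenR: "length R = N" by (simp add: R_def)
  have R_i: "occurs w R i" unfolding R_def by (rule occurs_subsequence)
  have end_eq: "i + N = j + length p" using p(4) by (simp add: N_def)
  have "palindrome R"
  proof (rule ccontr)
    assume npal: "\<not> palindrome R"
    obtain b where b: "occurs w (rev R) b" using rev_closed_occurs[OF rc R_i] .
    have ex: "\<exists>k. k < N \<and> w (i + k) \<noteq> w (b + k)"
    proof (rule ccontr)
      assume "\<not> ?thesis"
      then have "occurs w R b" unfolding R_def occurs_sub_iff by auto
      then show False using b npal by (simp add: occurs_iff palindrome_def)
    qed
    define k where "k = (LEAST k. k < N \<and> w (i + k) \<noteq> w (b + k))"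
    have k: "k < N" "w (i + k) \<noteq> w (b + k)"
      using LeastI_ex[OF ex] by (auto simp: k_def)
    have k_least: "w (b + m) = w (i + m)" if "m < k" for m
      using not_less_Least[OF that[unfolded k_def]] that k(1) by auto
    define u where "u = subsequence w i (i + k)"
    have u: "occurs w u i" "occurs w u b"
      using k_least unfolding u_def by (simp_all add: occurs_subsequence occurs_sub_iff)
    have rs: "right_special w u"
      unfolding right_special_iff
      by (rule exI[of _ i], rule exI[of _ b]) (use u k in \<open>auto simp: u_def\<close>)
    have "drop (j - i) R = p"
      using p(3,4) end_eq by (simp add: R_def occurs_iff)
    then have "rev R = p @ rev (take (j - i) R)"
      using p(1) by (metis append_take_drop_id palindrome_def rev_append)
    then have p_b: "occurs w p b" using b by (simp add: occurs_append)
    have "length p \<le> k"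
    proof (rule ccontr)
      assume "\<not> length p \<le> k"
      then show False using k(2) p(2) p_b by (auto simp: occurs_def)
    qed
    then have "take (length p) u = p"
      using p(2) by (simp add: u_def occurs_iff)
    then have "right_special w (p @ drop (length p) u)"
      using rs by (metis append_take_drop_id)
    \<comment> \<open>A later copy of \<open>R\<close> has enough letters on its left for the
      extension of \<open>p\<close>.\<close>
    moreover obtain i' where i': "i' \<ge> length (drop (length p) u)" "occurs w R i'"
      using rev_closed_recurrent[OF rc] R_i unfolding recurrent_iff by meson
    have same: "occurs w p (i + m) \<longleftrightarrow> occurs w p (i' + m)" if "m \<le> j - i" for m
    proof -
      have "w (i' + (m + l)) = w (i + (m + l))" if "l < length p" for l
        using i'(2) that \<open>m \<le> j - i\<close> unfolding R_def occurs_sub_iff by (simp add: N_def)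
      then show ?thesis by (simp add: occurs_def add.assoc)
    qed
    have "pal_window w i' (i' + (j - i) + length p)"
    proof (rule extended_return_pal[OF rc us calculation p(1)])
      show "occurs w p i'" using same[of 0] p by simp
      show "occurs w p (i' + (j - i))" using same[of "j - i"] p by simp
      show "\<not> occurs w p l" if "i' < l" "l < i' + (j - i)" for l
        using same[of "l - i'"] none[rule_format, of "i + (l - i')"] that by (simp add: less_diff_conv)
    qed (use p i' in auto)
    then show False
      using pal_window_occurs[OF i'(2)] npal by (simp add: lenR N_def add.assoc)
  qed
  then show "pal_window w i (j + length p)"
    using pal_window_occurs[OF R_i] by (simp add: lenR end_eq)
qed

text \<open>The longest palindromic suffix \<open>P\<close> is new at each letter: otherwise the
  return from its previous occurrence would be a longer palindromic suffix.\<close>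

lemma pal_returns_rich:
  assumes pr: "pal_returns w" shows "rich_word w"
proof -
  have "rich u" if "u \<in> factors w" for u
    using that
  proof (induction u rule: rev_induct)
    case Nil
    then show ?case unfolding rich_def pals_Nil by simp
  next
    case (snoc x u)
    define v where "v = u @ [x]"
    obtain i where i: "occurs w v i" using snoc.prems factors_iff unfolding v_def by blast
    define k where "k = (LEAST k. palindrome (drop k v))"
    have ex: "palindrome (drop (length u) v)" by (simp add: palindrome_def v_def)
    have k: "palindrome (drop k v)" "k \<le> length u"
      using LeastI[of "\<lambda>k. palindrome (drop k v)", OF ex]
        Least_le[of "\<lambda>k. palindrome (drop k v)", OF ex] by (auto simp: k_def)
    have k_least: "\<not> palindrome (drop m v)" if "m < k" for m
      using not_less_Least[of m "\<lambda>k. palindrome (drop k v)"] that by (simp add: k_def)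
    define P where "P = drop k v"
    have P_k: "occurs w P (i + k)" unfolding P_def by (rule occurs_drop[OF i]) (use k in \<open>simp add: v_def\<close>)
    have lenP: "k + length P = length v" using k by (simp add: P_def v_def)
    have "\<not> sublist P u"
    proof
      assume "sublist P u"
      then obtain a b where ab: "u = a @ P @ b" by (auto simp: sublist_def)
      then have "occurs w P (i + length a)" using i by (simp add: occurs_append v_def)
      moreover have "i + length a < i + k" using ab lenP by (simp add: v_def)
      ultimately obtain l where l: "occurs w P l" "i + length a \<le> l" "l < i + k"
        "\<And>l'. l < l' \<Longrightarrow> l' < i + k \<Longrightarrow> \<not> occurs w P l'"
        using last_before[of "occurs w P" "i + length a" "i + k"] by metis
      have "pal_window w l (i + k + length P)"
        using pr k(1) P_k l unfolding pal_returns_def P_def by blast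
      then have "palindrome (drop (l - i) v)"
        using pal_window_drop[OF i, of "l - i"] l k lenP by (simp add: add.assoc)
      then show False
        using k_least[of "l - i"] l by (metis add.commute add_leD1 less_diff_conv2)
    qed
    moreover have "Sublist.suffix P v" unfolding P_def by (rule suffix_drop)
    moreover have "rich u" using snoc factors_append1 by blast
    ultimately show ?case using rich_snoc k(1) P_def v_def by metis
  qed
  then show ?thesis by (simp add: rich_word_def)
qed

section \<open>Consequences of richness and balance\<close>

lemma pal_window_rev:
  assumes "pal_window w m (j + length u)" "occurs w u j" "m \<le> j"
  shows "occurs w (rev u) m"
  unfolding occurs_def
proof (intro allI impI)
  fix k assume k: "k < length (rev u)"
  have "w (m + k) = w (j + (length u - 1 - k))"
    by (rule pal_window_nth[OF assms(1)]) (use k assms(3) in auto)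
  also have "\<dots> = u ! (length u - 1 - k)"
    by (rule occursD[OF assms(2)]) (use k in simp)
  finally show "w (m + k) = rev u ! k" using k by (simp add: rev_nth)
qed

text \<open>The last letter of the segment from \<open>i\<close> to the end of the second
  \<open>u\<close> creates a palindrome. If it were no longer than \<open>u\<close>, it would be a
  suffix of \<open>u\<close> and hence already occur in the first copy.\<close>

lemma rich_border_palindrome:
  assumes rich: "rich_word w" and u: "occurs w u i" "occurs w u j" and ij: "i < j"
  obtains m where "i \<le> m" "m < j" "pal_window w m (j + length u)"
proof -
  \<comment> \<open>One less than the length of the segment, whose last letter is split off as
    \<open>x\<close>.\<close>
  define N where "N = j - i + length u - 1"
  define v where "v = subsequence w i (i + N)"
  define x where "x = w (i + N)"
  have len: "length (v @ [x]) = j - i + length u" using ij by (simp add: v_def N_def)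
  have occ: "occurs w (v @ [x]) i"
    unfolding occurs_append v_def by (simp add: occurs_subsequence x_def)
  then have "v @ [x] \<in> factors w" using factors_iff by blast
  then have "rich (v @ [x])" using rich by (simp add: rich_word_def)
  then obtain Q where Q: "palindrome Q" "Sublist.suffix Q (v @ [x])" "\<not> sublist Q v"
    by (rule rich_new_palindrome)
  define n where "n = length (v @ [x]) - length Q"
  have lenQ: "n + length Q = length (v @ [x])"
    using suffix_length_le[OF Q(2)] by (simp add: n_def)
  have Q_drop: "Q = drop n (v @ [x])"
    using suffix_take[OF Q(2)] unfolding n_def by (metis append_eq_conv_conj length_take min.cobounded2 suffix_length_le Q(2) diff_le_self min.absorb2)
  have "n < j - i"
  proof (rule ccontr)
    assume "\<not> n < j - i"
    then have le: "length Q \<le> length u" using lenQ len by simp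
    have "drop (j - i) (v @ [x]) = u"
    proof -
      have "occurs w (drop (j - i) (v @ [x])) j"
        using occurs_drop[OF occ, of "j - i"] len ij by simp
      moreover have "length (drop (j - i) (v @ [x])) = length u" using len by simp
      ultimately show ?thesis using u(2) unfolding occurs_iff by metis
    qed
    then have "Sublist.suffix u (v @ [x])" by (metis suffix_drop)
    then have "Sublist.suffix Q u" using Q(2) le suffix_length_suffix by blast
    moreover have "take (length u) v = u"
      using u(1) ij by (simp add: v_def N_def occurs_iff)
    ultimately have "sublist Q v"
      by (metis sublist_order.order_trans sublist_take suffix_imp_sublist)
    then show False using Q(3) by simp
  qed
  moreover have "i + length (v @ [x]) = j + length u" using len ij by linarith
  then have "pal_window w (i + n) (j + length u)"
    using pal_window_drop[OF occ, of n] Q(1) Q_drop lenQ by (metis le_add1)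
  ultimately show ?thesis using that[of "i + n"] by simp
qed

text \<open>A palindrome that ends with the second \<open>p\<close> also begins with
  \<open>p\<close>, so it must begin at \<open>i\<close>.\<close>

lemma rich_pal_returns:
  assumes "rich_word w" shows "pal_returns w"
  unfolding pal_returns_def
proof (intro allI impI, elim conjE)
  fix p i j
  assume p: "palindrome p" "occurs w p i" "occurs w p j" "i < j"
    and none: "\<forall>l. i < l \<and> l < j \<longrightarrow> \<not> occurs w p l"
  obtain m where m: "i \<le> m" "m < j" "pal_window w m (j + length p)"
    using rich_border_palindrome[OF assms p(2-4)] .
  have "occurs w p m" using pal_window_rev[OF m(3) p(3)] m(2) p(1) by (simp add: palindrome_def)
  then have "m = i" using none m by (metis le_neq_implies_less)
  then show "pal_window w i (j + length p)" using m by simp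
qed

text \<open>A palindrome ending with a second occurrence of \<open>u\<close> begins with
  \<open>rev u\<close>.\<close>

lemma rich_rev_closed:
  assumes "rich_word w" "recurrent w" shows "rev_closed w"
proof -
  have "rev u \<in> factors w" if "u \<in> factors w" for u
  proof -
    obtain i where i: "occurs w u i" using \<open>u \<in> factors w\<close> factors_iff by metis
    obtain j where j: "j \<ge> Suc i" "occurs w u j"
      using assms(2) i unfolding recurrent_iff by blast
    obtain m where "m < j" "pal_window w m (j + length u)"
      using rich_border_palindrome[OF assms(1) i j(2)] j(1) by auto
    then show ?thesis using pal_window_rev[of w m j u] j unfolding factors_iff by auto
  qed
  then show ?thesis by (simp add: rev_closed_def)
qed

section \<open>Comparing letter counts in balanced words\<close>

lemma balanced_count:
  assumes "balanced w" "u \<in> factors w" "v \<in> factors w" "length u = length v"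
  shows "count_list u x \<le> count_list v x + 1"
proof -
  have "\<bar>int (count_list u x) - int (count_list v x)\<bar> \<le> 1"
    using assms unfolding balanced_def by blast
  then show ?thesis by linarith
qed

lemma balanced_gap:
  assumes "balanced w" "u \<in> factors w" "v \<in> factors w" "length u \<le> length v"
    and "count_list u x \<ge> 2" "x \<notin> set v"
  shows False
proof -
  have "take (length u) v \<in> factors w"
    using assms(3) factors_append1[of "take (length u) v" "drop (length u) v"] by simp
  moreover have "count_list (take (length u) v) x = 0"
    using assms(6) in_set_takeD by (metis count_list_0_iff)
  ultimately show False
    using balanced_count[OF assms(1,2), of "take (length u) v" x] assms(4,5) by simp
qed

section \<open>Walks between consecutive occurrences of a palindrome\<close>

text \<open>The hypotheses describe the sequence of letters following the consecutive occurrences of a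
  bispecial palindrome; \<open>s\<close> is the only one of these letters that may occur in the palindrome.\<close>

lemma adjacency_star:
  fixes D :: "nat \<Rightarrow> 'a" and s :: 'a
  assumes step: "\<And>n. D n \<noteq> D (Suc n)"
    and ret: "\<And>i j. i < j \<Longrightarrow> D i = D j \<Longrightarrow> (\<And>k. i < k \<Longrightarrow> k < j \<Longrightarrow> D k \<noteq> D i) \<Longrightarrow>
      D (Suc i) = D (j - 1)"
    and rec: "\<And>n N. \<exists>m \<ge> N. D m = D n \<and> D (Suc m) = D (Suc n)"
    and bal: "\<And>i j. D i = D (i + 2) \<Longrightarrow> D (i + 1) \<noteq> s \<Longrightarrow> D (j + 1) \<noteq> s \<Longrightarrow>
      D i \<in> {D j, D (j + 1), D (j + 2)}"
    and bal2: "\<And>i j. D i = D (i + 2) \<Longrightarrow> D j = D (j + 2) \<Longrightarrow> D i \<noteq> s \<Longrightarrow> D j \<noteq> s \<Longrightarrow>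
      D i \<notin> {D j, D (j + 1)} \<Longrightarrow> D j \<notin> {D i, D (i + 1)} \<Longrightarrow> False"
  shows "\<exists>m. \<forall>n. D n = m \<or> D (Suc n) = m"
proof -
  \<comment> \<open>Lengths of closed walks that avoid \<open>s\<close> strictly inside; the
    shortest will turn out to have length 2.\<close>
  define good where "good l \<longleftrightarrow> (\<exists>i. D i = D (i + l) \<and> l > 0 \<and> (\<forall>k. i < k \<and> k < i + l \<longrightarrow> D k \<noteq> s))" for l
  have "\<exists>l. good l"
  proof (cases "s \<in> range D")
    case True
    then obtain n where n: "D n = s" by auto
    obtain m where m: "m \<ge> Suc n" "D m = s" using rec[of "Suc n" n] n by metis
    define j where "j = (LEAST j. j > n \<and> D j = s)"
    have ex: "m > n \<and> D m = s" using m by simp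
    have j: "j > n" "D j = s"
      using LeastI[of "\<lambda>j. j > n \<and> D j = s", OF ex] by (auto simp: j_def)
    have "D k \<noteq> s" if "n < k" "k < j" for k
      using not_less_Least[of k "\<lambda>j. j > n \<and> D j = s"] that by (auto simp: j_def)
    then have "good (j - n)" using j n unfolding good_def by (intro exI[of _ n]) auto
    then show ?thesis by blast
  next
    case False
    obtain m where "m \<ge> Suc 0" "D m = D 0" using rec[of "Suc 0" 0] by metis
    then have "good m" using False unfolding good_def by (intro exI[of _ 0]) auto
    then show ?thesis by blast
  qed
  define l where "l = (LEAST l. good l)"
  have "good l" using LeastI_ex[OF \<open>\<exists>l. good l\<close>] by (simp add: l_def)
  then obtain i where i: "D i = D (i + l)" "l > 0" "\<And>k. i < k \<Longrightarrow> k < i + l \<Longrightarrow> D k \<noteq> s"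
    unfolding good_def by blast
  have l_min: "\<not> good l'" if "l' < l" for l'
    using not_less_Least that by (simp add: l_def)
  have inner: "D k \<noteq> D i" if "i < k" "k < i + l" for k
  proof
    assume "D k = D i"
    then have "good (k - i)" using that i(3) unfolding good_def by (intro exI[of _ i]) auto
    then show False using l_min[of "k - i"] that by simp
  qed
  \<comment> \<open>By minimality the walk does not meet \<open>D i\<close> inside, so
    \<open>ret\<close> applies; cutting off both end steps leaves a closed walk shorter by
    2.\<close>
  have ends: "D (Suc i) = D (i + l - 1)"
    using ret[of i "i + l"] i inner by simp
  have "l = 2"
  proof -
    have "l \<noteq> 1" using step[of i] i(1) by auto
    moreover have False if "l > 2"
    proof -
      have "good (l - 2)"
        unfolding good_def
      proof (intro exI[of _ "Suc i"] conjI allI impI)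
        have "Suc i + (l - 2) = i + l - 1" using that by simp
        then show "D (Suc i) = D (Suc i + (l - 2))" using ends by (simp only:)
        show "D k \<noteq> s" if "Suc i < k \<and> k < Suc i + (l - 2)" for k
          by (rule i(3)) (use that in auto)
      qed (use that in simp)
      then show False using l_min[of "l - 2"] that by simp
    qed
    ultimately show ?thesis using i(2) by (metis One_nat_def Suc_1 linorder_neqE_nat less_2_cases not_gr_zero)
  qed
  \<comment> \<open>The walk goes from \<open>b\<close> to a letter other than \<open>s\<close> and
    back, so \<open>bal\<close> puts \<open>b\<close> into every three consecutive letters whose
    middle is not \<open>s\<close>.\<close>
  define b where "b = D i"
  have meets: "D j = b \<or> D (j + 1) = b \<or> D (j + 2) = b" if "D (j + 1) \<noteq> s" for j
    using bal[of i j] i(1) i(3)[of "i + 1"] that \<open>l = 2\<close> by (auto simp: b_def)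
  have tri: False if "D j = b" "D (j + 1) \<noteq> b" "D (j + 2) \<noteq> b" "D (j + 3) = b" for j
  proof -
    have "D k \<noteq> D j" if "j < k" "k < j + 3" for k
    proof -
      have "k = j + 1 \<or> k = j + 2" using that by arith
      then show ?thesis using \<open>D j = b\<close> \<open>D (j + 1) \<noteq> b\<close> \<open>D (j + 2) \<noteq> b\<close> by auto
    qed
    then have "D (Suc j) = D (j + 2)" using ret[of j "j + 3"] that(1,4) by simp
    then show False using step[of "Suc j"] by simp
  qed
  \<comment> \<open>An edge missing both \<open>b\<close> and \<open>s\<close> would have
    \<open>b\<close> on either side, which \<open>tri\<close> forbids. Recurrence with bound 1
    provides the letter before it.\<close>
  have edge: "D n = b \<or> D n = s \<or> D (Suc n) = b \<or> D (Suc n) = s" for n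
  proof (rule ccontr)
    assume c: "\<not> ?thesis"
    obtain m where m: "m \<ge> 1" "D m = D n" "D (Suc m) = D (Suc n)" using rec[of 1 n] by metis
    define j where "j = m - 1"
    have j: "D (j + 1) = D n" "D (j + 2) = D (Suc n)" using m by (simp_all add: j_def)
    have "D j = b" using meets[of j] c j by auto
    moreover have "D (j + 3) = b"
      using meets[of "j + 1"] c j by (auto simp: numeral_eq_Suc)
    ultimately show False using tri[of j] c j by auto
  qed
  show ?thesis
  proof (cases "s = b \<or> s \<notin> range D")
    case True
    then have "D n = b \<or> D (Suc n) = b" for n
      using edge[of n] by (metis rangeI)
    then show ?thesis by blast
  next
    case False
    then have sb: "s \<noteq> b" and "s \<in> range D" by auto
    \<comment> \<open>The walk leaves \<open>s\<close> to the letter it came from: otherwise it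
      contains a path from \<open>b\<close> to \<open>b\<close> of length 3, or one of length 4
      through \<open>s\<close> whose two other inner letters are equal by
      \<open>ret\<close>.\<close>
    have visit: "D (j + 1) = D (j + 3)" if s: "D (j + 2) = s" for j
    proof (rule ccontr)
      assume neq: "D (j + 1) \<noteq> D (j + 3)"
      have sn: "D (j + 1) \<noteq> s" "D (j + 3) \<noteq> s"
        using step[of "j + 1"] step[of "j + 2"] s by (auto simp: numeral_eq_Suc)
      have before: "D j = b" if "D (j + 1) \<noteq> b"
        using meets[of j] sn that s sb by auto
      have after: "D (j + 4) = b" if "D (j + 3) \<noteq> b"
        using meets[of "j + 2"] sn that s sb by (auto simp: numeral_eq_Suc)
      consider "D (j + 1) = b" "D (j + 3) \<noteq> b" | "D (j + 1) \<noteq> b" "D (j + 3) = b"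
        | "D (j + 1) \<noteq> b" "D (j + 3) \<noteq> b" using neq by auto
      then show False
      proof cases
        case 1
        then show False using tri[of "j + 1"] after s sb by (auto simp: numeral_eq_Suc)
      next
        case 2
        then show False using tri[of j] before s sb by auto
      next
        case 3
        have "D k \<noteq> D j" if "j < k" "k < j + 4" for k
        proof -
          have "k = j + 1 \<or> k = j + 2 \<or> k = j + 3" using that by arith
          then show ?thesis using 3 before[OF 3(1)] s sb by auto
        qed
        then have "D (Suc j) = D (j + 3)"
          using ret[of j "j + 4"] before[OF 3(1)] after[OF 3(2)] by (simp add: add.commute)
        then show False using neq by simp
      qed
    qed
    obtain n0 where "D n0 = s" using \<open>s \<in> range D\<close> by auto
    then obtain j0 where j0: "j0 \<ge> 2" "D j0 = s" using rec[of 2 n0] by metis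
    define u where "u = D (Suc j0)"
    \<comment> \<open>Between consecutive visits to \<open>s\<close>, \<open>ret\<close> equates the
      first and last letter, and \<open>visit\<close> carries the letter across \<open>s\<close>;
      hence \<open>s\<close> has the single neighbour \<open>u\<close>.\<close>
    have next_u: "D (Suc j) = u" if "j \<ge> j0" "D j = s" for j
      using that
    proof (induction j rule: less_induct)
      case (less j)
      show ?case
      proof (cases "j = j0")
        case False
        define Q where "Q l \<longleftrightarrow> D l = s" for l
        have "j0 < j" "Q j0" using less.prems False j0 by (auto simp: Q_def)
        then obtain l where l: "Q l" "j0 \<le> l" "l < j" "\<And>l'. l < l' \<Longrightarrow> l' < j \<Longrightarrow> \<not> Q l'"
          using last_before[of Q j0 j] by metis
        then have "D (Suc l) = u" using less.IH[of l] l by (auto simp: Q_def)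
        moreover have "D (Suc l) = D (j - 1)"
        proof (rule ret)
          show "D k \<noteq> D l" if "l < k" "k < j" for k
            using l that by (auto simp: Q_def)
        qed (use l less.prems in \<open>auto simp: Q_def\<close>)
        moreover have "D (j - 1) = D (Suc j)"
          using visit[of "j - 2"] less.prems j0 by (simp add: numeral_eq_Suc Suc_diff_Suc)
        ultimately show ?thesis by simp
      qed (simp add: u_def)
    qed
    have prev_u: "D n = u" if sn: "D (Suc n) = s" for n
    proof -
      obtain m where m: "m \<ge> j0" "D m = D n" "D (Suc m) = s" using rec[of j0 n] sn by metis
      have "D (m - 1 + 1) = D (m - 1 + 3)"
        using visit[of "m - 1"] m j0 by (simp add: numeral_eq_Suc)
      moreover have "D (Suc (Suc m)) = u" using next_u m by simp
      ultimately show ?thesis using m j0 by (simp add: numeral_eq_Suc)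
    qed
    have next_u': "D (Suc n) = u" if "D n = s" for n
      using next_u rec[of j0 n] that by metis
    show ?thesis
    proof (cases "u = b")
      case True
      then have "D n = b \<or> D (Suc n) = b" for n
        using edge[of n] prev_u next_u' by metis
      then show ?thesis by blast
    next
      case ub: False
      have us: "u \<noteq> s" using step[of j0] j0 by (simp add: u_def)
      show ?thesis
      proof (rule ccontr)
        assume "\<not> ?thesis"
        then obtain n where n: "D n \<noteq> u" "D (Suc n) \<noteq> u" by blast
        have ns: "D n \<noteq> s" "D (Suc n) \<noteq> s" using n prev_u next_u' by metis+
        \<comment> \<open>An edge avoiding \<open>u\<close> also avoids \<open>s\<close>, so it
          joins \<open>b\<close> to a further letter. The walk then contains a step from
          \<open>b\<close> to that letter and back, and one from \<open>u\<close> to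
          \<open>s\<close> and back, contrary to \<open>bal2\<close>.\<close>
        have "\<exists>k. D (k + 1) \<noteq> s \<and> D (k + 1) \<noteq> u \<and> D (k + 1) \<noteq> b"
        proof (cases "D n = b")
          case True
          then show ?thesis using n ns step[of n] by (intro exI[of _ n]) auto
        next
          case False
          obtain m where "m \<ge> 1" "D m = D n" using rec[of 1 n] by metis
          then show ?thesis using False n ns by (intro exI[of _ "m - 1"]) auto
        qed
        then obtain k where k: "D (k + 1) \<noteq> s" "D (k + 1) \<noteq> u" "D (k + 1) \<noteq> b" by blast
        have "D k \<noteq> s" "D (k + 2) \<noteq> s" using k prev_u[of "k + 1"] next_u'[of k] by auto
        then have kb: "D k = b" "D (k + 2) = b"
          using edge[of k] edge[of "k + 1"] k by auto
        define j where "j = j0 - 1"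
        have j: "D j = u" "D (j + 1) = s" "D (j + 2) = u"
          using prev_u[of j] j0 by (simp_all add: j_def u_def numeral_eq_Suc)
        show False using bal2[of k j] kb j k ub us sb by auto
      qed
    qed
  qed
qed

text \<open>The situation created by two distinct right special words of least length with common
  tail \<open>t\<close>, to be refuted. Uniqueness is available exactly up to the length of
  \<open>t\<close>.\<close>

locale bispecial_palindrome =
  fixes w :: "'a word" and t :: "'a list"
  assumes rc: "rev_closed w" and rec: "recurrent w" and pr: "pal_returns w"
    and bal: "balanced w"
    and us: "\<And>m. m \<le> length t \<Longrightarrow> unique_special w m"
    and rs: "right_special w t" and pal: "palindrome t"
    and no_star: "\<And>m. \<exists>u v. u # t @ [v] \<in> factors w \<and> m \<noteq> u \<and> m \<noteq> v"
begin

section \<open>Letters adjacent to \<open>t\<close>\<close>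

definition live :: "'a \<Rightarrow> bool" where
  "live x \<longleftrightarrow> x # t \<in> factors w"

text \<open>An edge avoiding \<open>x\<close> gives a word of the same length with two fewer
  occurrences of \<open>x\<close>.\<close>

lemma no_loop: "x # t @ [x] \<notin> factors w"
proof
  assume "x # t @ [x] \<in> factors w"
  moreover obtain u v where "u # t @ [v] \<in> factors w" "x \<noteq> u" "x \<noteq> v"
    using no_star by blast
  ultimately show False
    using balanced_count[OF bal, of "x # t @ [x]" "u # t @ [v]" x] by simp
qed

lemma edge_live:
  assumes "u # t @ [v] \<in> factors w" shows "live u" "live v"
proof -
  show "live u" using assms factors_append1[of "u # t" "[v]"] by (simp add: live_def)
  have "rev (u # t @ [v]) \<in> factors w" using assms rc unfolding rev_closed_def by blast
  then show "live v"
    using pal factors_append1[of "v # t" "[u]"] by (simp add: live_def palindrome_def)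
qed

lemma third_live: "\<exists>z. live z \<and> z \<noteq> x \<and> z \<noteq> y"
proof -
  obtain u v where "u # t @ [v] \<in> factors w" "x \<noteq> u" "x \<noteq> v"
    using no_star by blast
  then show ?thesis using edge_live[of u v] no_loop by metis
qed

text \<open>A right special factor of length at most the length of \<open>t\<close> is a suffix of \<open>t\<close>, so
  an extension of \<open>x\<close> can branch only after a suffix of \<open>t\<close> that begins with \<open>x\<close>.\<close>

lemma forced_right:
  assumes x: "live x" "x \<notin> set p" and t: "t = p @ q" and i: "w i = x"
  shows "occurs w p (Suc i)"
proof -
  obtain i0 where i0: "occurs w (x # t) i0"
    using x(1) unfolding live_def factors_iff by blast
  have p0: "occurs w p (Suc i0)" and x0: "w i0 = x"
    using i0 by (simp_all add: occurs_Cons t occurs_append)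
  have same: "w (Suc i + m) = w (Suc i0 + m)" if "m < length p" for m
    using that
  proof (induction m rule: less_induct)
    case (less m)
    show ?case
    proof (rule ccontr)
      assume neq: "w (Suc i + m) \<noteq> w (Suc i0 + m)"
      define u where "u = subsequence w i0 (i0 + Suc m)"
      have len: "length u = Suc m" unfolding u_def by (simp del: add_Suc_right)
      have "occurs w u i0" unfolding u_def by (rule occurs_subsequence)
      moreover have "occurs w u i"
        unfolding u_def occurs_sub_iff
      proof (intro allI impI)
        fix k assume k: "k < Suc m"
        show "w (i + k) = w (i0 + k)"
        proof (cases k)
          case 0
          then show ?thesis using i x0 by simp
        next
          case (Suc k')
          then show ?thesis using less.IH[of k'] less.prems k by simp
        qed
      qed
      moreover have "w (i + length u) \<noteq> w (i0 + length u)" using neq len by simp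
      ultimately have "right_special w u" unfolding right_special_iff by metis
      moreover define v where "v = drop (length t - Suc m) t"
      have le: "Suc m \<le> length t" using less.prems t by simp
      have "right_special w v"
        using rs right_special_suffix[of w "take (length t - Suc m) t" v] by (simp add: v_def)
      moreover have "length v = Suc m" using le by (simp add: v_def)
      ultimately have "u = v" using us[OF le] len unfolding unique_special_def by blast
      moreover have "x \<in> set u"
        using x0 unfolding u_def set_subsequence by (intro image_eqI[of _ _ i0]) auto
      \<comment> \<open>As \<open>t\<close> is a palindrome, its suffix \<open>v\<close> is the
        reversal of a prefix that lies within \<open>p\<close>, whereas \<open>u\<close> begins with
        \<open>x\<close>.\<close>
      moreover have "set v \<subseteq> set p"
      proof -
        have "rev v = take (Suc m) (rev t)" using le by (simp add: v_def rev_drop)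
        also have "\<dots> = take (Suc m) p" using pal less.prems t by (simp add: palindrome_def)
        finally show ?thesis by (metis set_rev set_take_subset)
      qed
      ultimately show False using x(2) by blast
    qed
  qed
  show ?thesis
    unfolding occurs_def
  proof (intro allI impI)
    fix k assume "k < length p"
    then show "w (Suc i + k) = p ! k" using same occursD[OF p0] by simp
  qed
qed

lemma forced_left:
  assumes x: "live x" "x \<notin> set t" and i: "w i = x" "length t \<le> i"
  shows "occurs w t (i - length t)"
proof -
  define y where "y = subsequence w (i - length t) i"
  have len: "length y = length t" using i by (simp add: y_def)
  have y: "occurs w y (i - length t)" unfolding y_def by (rule occurs_subsequence)
  have "occurs w (y @ [x]) (i - length t)" using y i len by (simp add: occurs_append)
  then obtain b where "occurs w (rev (y @ [x])) b" using rev_closed_occurs[OF rc] by blast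
  then have b: "w b = x" "occurs w (rev y) (Suc b)" by (simp_all add: occurs_Cons)
  have "occurs w t (Suc b)" using forced_right[OF x, of "[]" b] b by simp
  then have "rev y = t" using b(2) len unfolding occurs_iff by (metis length_rev)
  then have "y = t" using pal by (metis palindrome_def rev_rev_ident)
  then show ?thesis using y by simp
qed

text \<open>Both \<open>x # p @ [x]\<close> and the word \<open>rev p @ x' # p\<close> without
  \<open>x\<close> are factors, and for nonempty \<open>p\<close> the second is at least as long as
  the first.\<close>

lemma live_prefix_Nil:
  assumes x: "live x" "live x'" "x \<noteq> x'" and t: "t = p @ x # q" "x \<notin> set p" "x' \<notin> set p"
  shows "p = []"
proof (rule ccontr)
  assume "p \<noteq> []"
  have "(x # p @ [x]) @ q \<in> factors w" using x(1) unfolding live_def by (simp add: t(1))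
  then have xpx: "x # p @ [x] \<in> factors w" by (rule factors_append1)
  have "(x' # p) @ x # q \<in> factors w" using x(2) unfolding live_def by (simp add: t(1))
  then have "rev (x' # p) \<in> factors w"
    using rc factors_append1 unfolding rev_closed_def by blast
  then obtain i where i: "occurs w (rev p) i" "w (i + length p) = x'"
    unfolding factors_iff by (auto simp: occurs_append)
  have "occurs w p (Suc (i + length p))" by (rule forced_right[OF x(2) t(3) t(1) i(2)])
  then have "occurs w (rev p @ x' # p) i" using i by (simp add: occurs_append occurs_Cons)
  then have "rev p @ x' # p \<in> factors w" unfolding factors_iff by blast
  then show False
    using balanced_gap[OF bal xpx, of "rev p @ x' # p" x] t(2) x(3) \<open>p \<noteq> []\<close>
    by (simp add: Suc_le_eq)
qed

text \<open>Otherwise a third live letter \<open>z\<close> lies in \<open>t\<close> before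
  \<open>x\<close>, and exchanging the roles of \<open>x\<close> and \<open>z\<close> makes
  \<open>z\<close> the first letter of \<open>t\<close>.\<close>

lemma live_in_set:
  assumes x: "live x" "x \<in> set t"
  shows "x = hd t"
proof (rule ccontr)
  assume neq: "x \<noteq> hd t"
  obtain p q where t: "t = p @ x # q" "x \<notin> set p" using split_list_first[OF x(2)] by blast
  then have "p \<noteq> []" using neq by auto
  obtain z where z: "live z" "z \<noteq> x" "z \<noteq> hd t" using third_live by blast
  have "z \<in> set p" using live_prefix_Nil[OF x(1) z(1) _ t] z(2) \<open>p \<noteq> []\<close> by blast
  then obtain p1 p2 where p: "p = p1 @ z # p2" "z \<notin> set p1" using split_list_first by metis
  have "p1 = []"
    by (rule live_prefix_Nil[OF z(1) x(1) z(2), of p1 "p2 @ x # q"]) (use t p in auto)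
  then show False using z t p by simp
qed

section \<open>The walk given by successive occurrences of \<open>t\<close>\<close>

definition pos :: "nat \<Rightarrow> nat" where
  "pos = enumerate {i. occurs w t i}"

definition D :: "nat \<Rightarrow> 'a" where
  "D n = w (pos n + length t)"

lemma infinite_occ: "infinite {i. occurs w t i}"
  using rec right_special_factor[OF rs] unfolding infinite_nat_iff_unbounded_le recurrent_iff factors_iff
  by auto

lemma pos_occurs: "occurs w t (pos n)"
  using enumerate_in_set[OF infinite_occ] by (simp add: pos_def)

lemma pos_less_iff: "pos m < pos n \<longleftrightarrow> m < n"
  unfolding pos_def using enumerate_mono_iff[OF infinite_occ] by simp

lemma pos_ex: "occurs w t l \<Longrightarrow> \<exists>n. l = pos n"
  using enumerate_Ex[of "{i. occurs w t i}" l] infinite_occ unfolding pos_def by auto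

lemma pos_none: "pos n < l \<Longrightarrow> l < pos (Suc n) \<Longrightarrow> \<not> occurs w t l"
  using pos_ex[of l] pos_less_iff by (metis less_antisym not_less_eq)

lemma pos_step: "pos n < pos (Suc n)"
  by (simp add: pos_less_iff)

lemma block_pal: "pal_window w (pos n) (pos (Suc n) + length t)"
  using pr pal pos_occurs pos_step pos_none unfolding pal_returns_def by blast

text \<open>The return between the two occurrences is a palindrome, so its letter after the first
  \<open>t\<close> is also the letter before the second; consecutive values of \<open>D\<close> are
  thus edges.\<close>

lemma D_before: "w (pos (Suc n) - 1) = D n"
  unfolding D_def
  by (rule pal_window_nth[OF block_pal[of n], symmetric]) (use pos_step[of n] in auto)

lemma edge_occurs: "occurs w (D n # t @ [D (Suc n)]) (pos (Suc n) - 1)"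
  using D_before[of n] pos_occurs[of "Suc n"] pos_step[of n]
  by (simp add: occurs_Cons occurs_append D_def)

lemma D_live: "live (D n)"
  using edge_occurs[of n] edge_live(1) unfolding factors_iff by blast

lemma D_step: "D n \<noteq> D (Suc n)"
  using edge_occurs[of n] no_loop unfolding factors_iff by metis

lemma edge_recurs:
  assumes "u # t @ [v] \<in> factors w"
  shows "\<exists>m \<ge> N. D m = u \<and> D (Suc m) = v"
proof -
  obtain i where i: "i \<ge> pos N" "occurs w (u # t @ [v]) i"
    using assms rec unfolding factors_iff recurrent_iff by blast
  then have t: "occurs w t (Suc i)" "w i = u" "w (Suc i + length t) = v"
    by (simp_all add: occurs_Cons occurs_append)
  obtain n where n: "Suc i = pos n" using pos_ex[OF t(1)] by blast
  have "N < n" using i(1) n pos_less_iff[of N n] by simp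
  then obtain m where m: "n = Suc m" "m \<ge> N" by (cases n) auto
  have "D m = u" using D_before[of m] n m t by (metis diff_Suc_1)
  moreover have "D (Suc m) = v" using n m t by (simp add: D_def)
  ultimately show ?thesis using m by blast
qed

text \<open>The return \<open>P\<close> to \<open>t\<close> at \<open>pos i\<close> recurs exactly
  where \<open>t\<close> is followed by \<open>D i\<close>. The stretch to \<open>pos j\<close> is
  therefore a complete return to \<open>P\<close>, and its mirror symmetry exchanges the two
  letters.\<close>

lemma D_return:
  assumes ij: "i < j" "D i = D j" and none: "\<And>k. i < k \<Longrightarrow> k < j \<Longrightarrow> D k \<noteq> D i"
  shows "D (Suc i) = D (j - 1)"
proof -
  define L where "L = pos (Suc i) - pos i + length t"
  define P where "P = subsequence w (pos i) (pos i + L)"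
  have len: "length P = L" by (simp add: P_def)
  have L: "pos i + L = pos (Suc i) + length t" using pos_step[of i] by (simp add: L_def)
  have P_i: "occurs w P (pos i)" unfolding P_def by (rule occurs_subsequence)
  have P_pal: "palindrome P"
    using pal_window_occurs[OF P_i] block_pal[of i] L len by simp
  have P_j: "occurs w P (pos j)"
    unfolding P_def occurs_sub_iff
  proof (intro allI impI)
    fix k assume "k < L"
    have "w (pos i + k) = w (pos j + k)"
      by (rule return_forced[OF us[OF le_refl] rs pos_occurs pos_occurs, of i "pos (Suc i)" j])
        (use pos_none ij(2) \<open>k < L\<close> in \<open>auto simp: D_def L_def\<close>)
    then show "w (pos j + k) = w (pos i + k)" by simp
  qed
  have P_none: "\<not> occurs w P l" if "pos i < l" "l < pos j" for l
  proof
    assume l: "occurs w P l"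
    have lt: "length t < L" using pos_step[of i] by (simp add: L_def)
    have "w (l + k) = w (pos i + k)" if "k < L" for k
      using l that unfolding P_def occurs_sub_iff by blast
    then have "occurs w t l" "w (l + length t) = D i"
      using pos_occurs[of i] lt by (auto simp: occurs_def D_def)
    then obtain m where "l = pos m" "D m = D i" using pos_ex[of l] by (auto simp: D_def)
    then show False using none[of m] that pos_less_iff by blast
  qed
  have win: "pal_window w (pos i) (pos j + length P)"
    using pr P_pal P_i P_j pos_less_iff[of i j] ij(1) P_none unfolding pal_returns_def by blast
  have "D (Suc i) = w (pos i + length P)" using L len by (simp add: D_def)
  also have "\<dots> = w (pos j - 1)"
    by (rule pal_window_nth[OF win]) (use pos_less_iff[of i j] ij(1) in auto)
  also have "\<dots> = D (j - 1)" using D_before[of "j - 1"] ij(1) by simp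
  finally show ?thesis .
qed

section \<open>Balance applied to words around two consecutive occurrences of
  \<open>t\<close>\<close>

definition block :: "nat \<Rightarrow> 'a list" where
  "block n = D n # subsequence w (pos (Suc n)) (pos (Suc (Suc n)) + length t) @ [D (Suc (Suc n))]"

lemma block_factor: "block n \<in> factors w"
proof -
  have "occurs w (block n) (pos (Suc n) - 1)"
    using D_before[of n] pos_step[of n] pos_step[of "Suc n"]
    by (simp add: block_def occurs_Cons occurs_append occurs_subsequence D_def)
  then show ?thesis unfolding factors_iff by blast
qed

text \<open>An occurrence of \<open>x\<close> must lie between the two copies of \<open>t\<close>,
  and \<open>forced_left\<close> puts a copy of \<open>t\<close> right before it, which can only be
  the first.\<close>

lemma not_in_block:
  assumes x: "live x" "x \<notin> set t" and "x \<noteq> D (Suc n)"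
  shows "x \<notin> set (subsequence w (pos (Suc n)) (pos (Suc (Suc n)) + length t))"
proof
  let ?a = "pos (Suc n)" and ?b = "pos (Suc (Suc n))"
  assume "x \<in> set (subsequence w ?a (?b + length t))"
  then obtain p where p: "?a \<le> p" "p < ?b + length t" "w p = x" by auto
  have no_t: "\<not> (m \<le> p \<and> p < m + length t)" if "occurs w t m" for m
  proof
    assume "m \<le> p \<and> p < m + length t"
    then have "x = t ! (p - m)" "p - m < length t"
      using occursD[OF that, of "p - m"] p(3) by auto
    then show False using x(2) by auto
  qed
  have p': "?a + length t \<le> p" "p < ?b"
    using no_t[OF pos_occurs[of "Suc n"]] no_t[OF pos_occurs[of "Suc (Suc n)"]] p by linarith+
  then have "occurs w t (p - length t)" using forced_left[OF x p(3)] by simp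
  then have "p - length t = ?a" using pos_none[of "Suc n" "p - length t"] p' by linarith
  then have "p = ?a + length t" using p'(1) by linarith
  then show False using assms(3) p(3) by (simp add: D_def)
qed

lemma block_long:
  assumes "D (Suc n) \<notin> set t"
  shows "block n = D n # t @ D (Suc n) # t @ [D (Suc (Suc n))]"
proof -
  let ?a = "pos (Suc n)" and ?b = "pos (Suc (Suc n))"
  have right: "occurs w t (Suc (?a + length t))"
    by (rule forced_right[OF D_live assms, of "[]"]) (simp_all add: D_def)
  then obtain m where m: "Suc (?a + length t) = pos m" using pos_ex by blast
  have "?b = Suc (?a + length t)"
  proof (rule ccontr)
    assume neq: "?b \<noteq> Suc (?a + length t)"
    have "Suc n < m" using m pos_less_iff[of "Suc n" m] by simp
    then have "?b \<le> pos m" using pos_less_iff[of m "Suc (Suc n)"] by linarith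
    then have b: "?a < ?b" "?b \<le> ?a + length t" using neq m pos_step[of "Suc n"] by linarith+
    then have "D (Suc n) = t ! (?a + length t - ?b)" "?a + length t - ?b < length t"
      using occursD[OF pos_occurs[of "Suc (Suc n)"], of "?a + length t - ?b"] by (auto simp: D_def)
    then show False using assms by auto
  qed
  moreover have "occurs w (t @ D (Suc n) # t) ?a"
    using pos_occurs[of "Suc n"] right by (simp add: occurs_append occurs_Cons D_def)
  then have "subsequence w ?a (?a + length (t @ D (Suc n) # t)) = t @ D (Suc n) # t"
    unfolding occurs_iff .
  ultimately show ?thesis by (simp add: block_def add.assoc)
qed

text \<open>Both blocks have the shape of \<open>block_long\<close>, so the copies of
  \<open>t\<close> contribute equally to the counts.\<close>

lemma block_balanced:
  assumes "D i = D (i + 2)" "D (i + 1) \<noteq> hd t" "D (j + 1) \<noteq> hd t"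
  shows "D i \<in> {D j, D (j + 1), D (j + 2)}"
proof (rule ccontr)
  assume notin: "D i \<notin> {D j, D (j + 1), D (j + 2)}"
  have "D (Suc i) \<notin> set t" "D (Suc j) \<notin> set t"
    using assms live_in_set[OF D_live] by auto
  note b = block_long[OF this(1)] block_long[OF this(2)]
  have "count_list (block i) (D i) \<le> count_list (block j) (D i) + 1"
    by (rule balanced_count[OF bal block_factor block_factor]) (simp add: b)
  moreover have "D (Suc (Suc i)) = D i" "D (Suc i) \<noteq> D i"
    "D j \<noteq> D i" "D (Suc j) \<noteq> D i" "D (Suc (Suc j)) \<noteq> D i"
    using notin assms(1) D_step[of i] by (auto simp: numeral_2_eq_2)
  ultimately show False by (simp add: b)
qed

text \<open>Each block has its own letter at both ends and lacks that of the other;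
  \<open>balanced_gap\<close> applies to the shorter one.\<close>

lemma block_gap:
  assumes "D i = D (i + 2)" "D j = D (j + 2)" "D i \<noteq> hd t" "D j \<noteq> hd t"
    and "D i \<notin> {D j, D (j + 1)}" "D j \<notin> {D i, D (i + 1)}"
  shows False
proof -
  have *: False if "D i = D (i + 2)" "D j = D (j + 2)" "D i \<noteq> hd t"
    "D i \<notin> {D j, D (j + 1)}" "length (block i) \<le> length (block j)" for i j
  proof (rule balanced_gap[OF bal block_factor block_factor that(5), of "D i"])
    show "2 \<le> count_list (block i) (D i)"
      using that(1) by (simp add: block_def numeral_2_eq_2)
    have "D i \<notin> set t" using live_in_set[OF D_live] that(3) by blast
    then show "D i \<notin> set (block j)"
      using not_in_block[OF D_live, of i j] that(2,4) unfolding block_def by (simp add: numeral_2_eq_2)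
  qed
  show ?thesis
    using *[of i j] *[of j i] assms by (meson nat_le_linear)
qed

lemma bispecial_contradiction: False
proof -
  have "\<exists>m. \<forall>n. D n = m \<or> D (Suc n) = m"
  \<comment> \<open>By \<open>live_in_set\<close> only \<open>hd t\<close> among the live letters
    can occur in \<open>t\<close>. For empty \<open>t\<close> it is an arbitrary letter, which the
    walk lemma allows.\<close>
  proof (rule adjacency_star[where s = "hd t"])
    show "\<exists>m \<ge> N. D m = D n \<and> D (Suc m) = D (Suc n)" for n N
      using edge_recurs edge_occurs[of n] unfolding factors_iff by blast
  qed (fact D_step D_return block_balanced block_gap)+
  then obtain m where m: "\<And>n. D n = m \<or> D (Suc n) = m" by blast
  obtain u v where "u # t @ [v] \<in> factors w" "m \<noteq> u" "m \<noteq> v" using no_star by blast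
  then show False using edge_recurs[of u v 0] m by metis
qed

end

text \<open>In a first failure the two words share their tail \<open>t\<close> by induction. Their
  reversals make \<open>rev t\<close> right special, so \<open>t\<close> is a palindrome; two left
  letters with two right letters each leave no common vertex.\<close>

lemma balanced_unique_special:
  assumes rc: "rev_closed w" and rec: "recurrent w" and pr: "pal_returns w" and bal: "balanced w"
  shows "unique_special w n"
proof (induction n rule: less_induct)
  case (less n)
  show ?case
    unfolding unique_special_def
  proof (intro allI impI, elim conjE)
    fix u v
    assume uv: "length u = n" "length v = n" "right_special w u" "right_special w v"
    show "u = v"
    proof (cases n)
      case 0
      then show ?thesis using uv by simp
    next
      case (Suc m)
      obtain y t where u: "u = y # t" using uv(1) Suc by (cases u) auto
      obtain z t' where v: "v = z # t'" using uv(2) Suc by (cases v) auto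
      have rs: "right_special w t" "right_special w t'"
        using uv(3,4) right_special_suffix[of w "[y]" t] right_special_suffix[of w "[z]" t']
        by (simp_all add: u v)
      have len: "length t = m" "length t' = m" using uv u v Suc by auto
      have us: "unique_special w k" if "k \<le> length t" for k
        using less.IH that len Suc by simp
      have t': "t' = t" using us[of m] rs len unfolding unique_special_def by simp
      show ?thesis
      proof (rule ccontr)
        assume "u \<noteq> v"
        then have yz: "y \<noteq> z" using u v t' by simp
        obtain a b where ab: "a \<noteq> b" "y # t @ [a] \<in> factors w" "y # t @ [b] \<in> factors w"
          using uv(3) unfolding right_special_def u by auto
        obtain c d where cd: "c \<noteq> d" "z # t @ [c] \<in> factors w" "z # t @ [d] \<in> factors w"
          using uv(4) unfolding right_special_def v t' by auto
        have "rev (y # t) \<in> factors w" "rev (z # t) \<in> factors w"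
          using rc right_special_factor[OF uv(3)] right_special_factor[OF uv(4)]
          unfolding rev_closed_def u v t' by blast+
        then have "right_special w (rev t)"
          using yz unfolding right_special_def by auto
        then have "rev t = t"
          using us[of m] rs(1) len unfolding unique_special_def by simp
        interpret bispecial_palindrome w t
        proof
          show "\<exists>u v. u # t @ [v] \<in> factors w \<and> m \<noteq> u \<and> m \<noteq> v" for m
            using ab cd yz by metis
        qed (use rc rec pr bal us rs \<open>rev t = t\<close> in \<open>auto simp: palindrome_def\<close>)
        show False by (rule bispecial_contradiction)
      qed
    qed
  qed
qed

section \<open>Assembling the equivalence\<close>

lemma episturmian_iff: "episturmian w \<longleftrightarrow> rev_closed w \<and> (\<forall>n. unique_special w n)"
proof -
  have "(\<exists>\<^sub>\<le>\<^sub>1 u. u \<in> factors w \<and> length u = n \<and> right_special w u) \<longleftrightarrow> unique_special w n" for n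
    unfolding Uniq_def unique_special_def using right_special_factor[of w] by blast
  then show ?thesis by (simp add: episturmian_def rev_closed_def)
qed

theorem theorem5p2:
  fixes A :: "'a set" and w :: "'a word"
  assumes "finite A" and "range w \<subseteq> A"
  shows "(recurrent w \<and> balanced w \<and> rich_word w) \<longleftrightarrow> (balanced w \<and> episturmian w)"
proof
  assume "recurrent w \<and> balanced w \<and> rich_word w"
  then show "balanced w \<and> episturmian w"
    using rich_rev_closed rich_pal_returns balanced_unique_special episturmian_iff by metis
next
  assume "balanced w \<and> episturmian w"
  then show "recurrent w \<and> balanced w \<and> rich_word w"
    using rev_closed_recurrent episturmian_pal_returns pal_returns_rich episturmian_iff by metis
qed

end
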